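(* Let $f$ and $g$ be distinct elements of a matroid $M$ such that $f$ is freer than $g$ in $M$. Then $b(f;M)=b(g;M)$ if and only if $f$ and $g$ are clones in $M$.
   Context: For distinct elements $f,g$ of a matroid $M$, $f$ is freer than $g$ if $g$ is contained in the closure of every circuit of $M$ that contains $f$. $b(e;M)$ is the number of bases of $M$ containing $e$. Elements $x,y$ of $M$ are clones if the bijection $E(M)\to E(M)$ that interchanges $x$ and $y$ and fixes every other element is an automorphism of $M$. *)

theory Defs
  imports "HOL-Combinatorics.Transposition"
begin

locale matroid =
  fixes E :: "'a set" and indep :: "'a set \<Rightarrow> bool"
  assumes finite_ground: "finite E"
    and indep_subset_ground: "indep X \<Longrightarrow> X \<subseteq> E"
    and indep_empty: "indep {}"
    and indep_subset: "indep Y \<Longrightarrow> X \<subseteq> Y \<Longrightarrow> indep X"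
    and indep_augment:
      "indep X \<Longrightarrow> indep Y \<Longrightarrow> card X < card Y \<Longrightarrow> \<exists>y\<in>Y - X. indep (insert y X)"
begin

definition basis :: "'a set \<Rightarrow> bool" where
  "basis B \<longleftrightarrow> indep B \<and> (\<forall>X. indep X \<and> B \<subseteq> X \<longrightarrow> X = B)"

definition circuit :: "'a set \<Rightarrow> bool" where
  "circuit C \<longleftrightarrow> C \<subseteq> E \<and> \<not> indep C \<and> (\<forall>X. X \<subset> C \<longrightarrow> indep X)"

definition rank :: "'a set \<Rightarrow> nat" where
  "rank X = Max {card I |I. I \<subseteq> X \<and> indep I}"

definition cl :: "'a set \<Rightarrow> 'a set" where
  "cl X = {e \<in> E. rank (insert e X) = rank X}"

definition freer :: "'a \<Rightarrow> 'a \<Rightarrow> bool" where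
  "freer f g \<longleftrightarrow> (\<forall>C. circuit C \<and> f \<in> C \<longrightarrow> g \<in> cl C)"

definition num_bases_containing :: "'a \<Rightarrow> nat" where
  "num_bases_containing e = card {B. basis B \<and> e \<in> B}"

definition automorphism :: "('a \<Rightarrow> 'a) \<Rightarrow> bool" where
  "automorphism h \<longleftrightarrow> bij_betw h E E \<and> (\<forall>X\<subseteq>E. indep (h ` X) \<longleftrightarrow> indep X)"

definition clones :: "'a \<Rightarrow> 'a \<Rightarrow> bool" where
  "clones x y \<longleftrightarrow> automorphism (transpose x y)"

end

end

theory Submission
  imports Defs
begin

text \<open>
  Interchanging \<open>f\<close> and \<open>g\<close> keeps every independent set \<open>I\<close> with \<open>g \<in> I\<close> independent: otherwise
  \<open>(I - {g}) \<union> {f}\<close> contains a circuit \<open>C\<close> through \<open>f\<close>, and the independent set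
  \<open>(C - {f}) \<union> {g} \<subseteq> I\<close> shows \<open>g \<notin> cl C\<close>. So the interchange injects the bases containing \<open>g\<close> into
  those containing \<open>f\<close>. The numbers agree iff this injection is onto, that is, iff the interchange
  also preserves the bases containing \<open>f\<close>, and hence all independent sets.
\<close>

context matroid
begin

lemma finite_indep: "indep I \<Longrightarrow> finite I"
  using finite_ground indep_subset_ground finite_subset by blast

lemma finite_Collect_indep: "finite {I. indep I}"
  by (rule finite_subset[of _ "Pow E"]) (use finite_ground indep_subset_ground in auto)

lemma finite_Collect_basis: "finite {B. basis B \<and> P B}"
  by (rule finite_subset[OF _ finite_Collect_indep]) (auto simp: basis_def)

lemma indep_extends_to_basis:
  assumes "indep I"
  obtains B where "basis B" "I \<subseteq> B"
proof -
  obtain B where "indep B" "I \<subseteq> B" "\<forall>X\<in>{I. indep I}. B \<le> X \<longrightarrow> B = X"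
    using finite_has_maximal2[OF finite_Collect_indep, of I] assms by auto
  then have "basis B" by (auto simp: basis_def)
  with \<open>I \<subseteq> B\<close> show thesis by (rule that[rotated])
qed

lemma dependent_contains_circuit:
  assumes "D \<subseteq> E" "\<not> indep D"
  obtains C where "circuit C" "C \<subseteq> D"
proof -
  have "finite {X. X \<subseteq> E \<and> \<not> indep X}"
    by (rule finite_subset[of _ "Pow E"]) (use finite_ground in auto)
  then obtain C where C: "C \<subseteq> E" "\<not> indep C" "C \<subseteq> D"
      "\<forall>X\<in>{X. X \<subseteq> E \<and> \<not> indep X}. X \<le> C \<longrightarrow> C = X"
    using finite_has_minimal2[of "{X. X \<subseteq> E \<and> \<not> indep X}" D] assms by auto
  then have "circuit C" unfolding circuit_def by blast
  with C(3) show thesis by (rule that[rotated])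
qed

text \<open>Makes the \<open>Max\<close> in \<open>rank\<close> usable: it bounds every member and,
  since the empty set is independent, it is attained.\<close>

lemma finite_card_indep_subsets: "finite {card I |I. I \<subseteq> X \<and> indep I}"
  by (rule finite_subset[of _ "card ` {I. indep I}"]) (auto simp: finite_Collect_indep)

lemma card_le_rank: "indep I \<Longrightarrow> I \<subseteq> X \<Longrightarrow> card I \<le> rank X"
  unfolding rank_def by (rule Max_ge[OF finite_card_indep_subsets]) auto

text \<open>The rank is attained by an independent subset of \<open>C\<close>, which is proper
  because \<open>C\<close> is dependent.\<close>

lemma rank_circuit_less_card:
  assumes "circuit C"
  shows "rank C < card C"
proof -
  have "finite C"
    using assms finite_ground finite_subset unfolding circuit_def by blast
  then have "card I < card C" if "I \<subseteq> C" "indep I" for I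
    using that assms unfolding circuit_def by (metis psubsetI psubset_card_mono)
  moreover have "rank C \<in> {card I |I. I \<subseteq> C \<and> indep I}"
    unfolding rank_def by (rule Max_in[OF finite_card_indep_subsets]) (use indep_empty in auto)
  ultimately show ?thesis by auto
qed

text \<open>A proper independent superset of \<open>I\<close> would be larger than \<open>B\<close>,
  and augmentation would then enlarge the basis \<open>B\<close>.\<close>

lemma basis_if_card_eq:
  assumes "basis B" "indep I" "card I = card B"
  shows "basis I"
  unfolding basis_def
proof (intro conjI allI impI)
  fix X assume X: "indep X \<and> I \<subseteq> X"
  show "X = I"
  proof (rule ccontr)
    assume "X \<noteq> I"
    then have "card B < card X"
      using X assms(3) finite_indep by (metis psubsetI psubset_card_mono)
    then obtain y where "y \<in> X - B" "indep (insert y B)"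
      using indep_augment X assms(1) unfolding basis_def by blast
    then show False using assms(1) unfolding basis_def by blast
  qed
qed (fact assms(2))

lemma freer_exchange:
  assumes "freer f g" "f \<in> E" "indep I" "g \<in> I" "f \<notin> I"
  shows "indep (insert f (I - {g}))"
proof (rule ccontr)
  assume "\<not> ?thesis"
  moreover have "insert f (I - {g}) \<subseteq> E"
    using assms indep_subset_ground by blast
  ultimately obtain C where C: "circuit C" "C \<subseteq> insert f (I - {g})"
    using dependent_contains_circuit by metis
  have "f \<in> C"
  proof (rule ccontr)
    assume "f \<notin> C"
    then have "indep C" using C(2) assms(3) indep_subset by blast
    then show False using C(1) by (simp add: circuit_def)
  qed
  then have rank: "rank (insert g C) = rank C"
    using assms(1) C(1) unfolding freer_def cl_def by blast
  have "finite C" "g \<notin> C"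
    using C assms(3-5) finite_indep[of I] by (auto intro: finite_subset)
  \<comment> \<open>Trading \<open>f\<close> for \<open>g\<close> keeps the size of \<open>C\<close>
    and lands inside \<open>I\<close>. So \<open>insert g C\<close> has rank at least
    \<open>card C\<close>, which exceeds \<open>rank C\<close>, although \<open>g\<close> lies in
    \<open>cl C\<close>.\<close>
  then have "card (insert g (C - {f})) = card C"
    using \<open>f \<in> C\<close> by (metis Diff_iff card.remove card_insert_disjoint finite_Diff)
  moreover have "indep (insert g (C - {f}))"
    by (rule indep_subset[OF assms(3)]) (use C(2) assms(4) in auto)
  ultimately have "card C \<le> rank (insert g C)"
    using card_le_rank[of "insert g (C - {f})" "insert g C"] by auto
  then show False using rank rank_circuit_less_card[OF C(1)] by simp
qed

text \<open>The last premise excludes only the sets containing \<open>f\<close> but not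
  \<open>g\<close>, where freeness says nothing. It holds both for bases through \<open>g\<close>
  and for independent sets avoiding \<open>f\<close>.\<close>

lemma freer_indep_transpose:
  assumes "freer f g" "f \<in> E" "indep I" "f \<in> I \<longrightarrow> g \<in> I"
  shows "indep (transpose f g ` I)"
proof (cases "g \<in> I \<and> f \<notin> I")
  case True
  then have "transpose f g ` I = insert f (I - {g})"
    by (auto simp: transpose_def image_iff)
  then show ?thesis using freer_exchange assms True by simp
next
  case False
  then have "f \<in> I \<longleftrightarrow> g \<in> I" using assms(4) by blast
  then have "transpose f g ` I = I" by (rule transpose_image_eq)
  then show ?thesis using assms(3) by simp
qed

lemma basis_transpose:
  assumes "basis B" "indep (transpose f g ` B)"
  shows "basis (transpose f g ` B)"
  by (rule basis_if_card_eq[OF assms]) (simp add: card_image inj_on_subset[OF inj_transpose])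

text \<open>Preservation in one direction suffices because a transposition is an involution: applied
  to the image of \<open>X\<close>, it gives back \<open>X\<close>.\<close>

lemma clones_iff:
  assumes "f \<in> E" "g \<in> E"
  shows "clones f g \<longleftrightarrow> (\<forall>I. indep I \<longrightarrow> indep (transpose f g ` I))"
proof
  assume "clones f g"
  then show "\<forall>I. indep I \<longrightarrow> indep (transpose f g ` I)"
    using indep_subset_ground by (auto simp: clones_def automorphism_def)
next
  assume preserves: "\<forall>I. indep I \<longrightarrow> indep (transpose f g ` I)"
  have "indep (transpose f g ` X) \<longleftrightarrow> indep X" for X
    using preserves[rule_format, of X] preserves[rule_format, of "transpose f g ` X"]
    by (auto simp: image_image)
  moreover have "bij_betw (transpose f g) E E"
    using assms by (simp add: bij_betw_def inj_on_subset[OF inj_transpose] transpose_image_eq)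
  ultimately show "clones f g"
    by (simp add: clones_def automorphism_def)
qed

theorem freer_num_bases_eq_iff_clones:
  assumes "freer f g" "f \<in> E" "g \<in> E"
  shows "num_bases_containing f = num_bases_containing g \<longleftrightarrow> clones f g"
proof -
  let ?T = "image (transpose f g)"
  let ?Bf = "{B. basis B \<and> f \<in> B}" and ?Bg = "{B. basis B \<and> g \<in> B}"
  have inj: "inj_on ?T \<A>" for \<A>
    by (rule inj_on_inverseI[of _ ?T]) (simp add: image_image)
  have into: "?T ` ?Bg \<subseteq> ?Bf"
  proof clarify
    fix B assume B: "basis B" "g \<in> B"
    then have "basis (?T B)"
      using freer_indep_transpose[OF assms(1,2), of B] basis_transpose
      by (simp add: basis_def)
    moreover have "f \<in> ?T B" using B(2) by (metis imageI transpose_apply_second)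
    ultimately show "basis (?T B) \<and> f \<in> ?T B" ..
  qed
  have "num_bases_containing f = num_bases_containing g \<longleftrightarrow> card (?T ` ?Bg) = card ?Bf"
    by (auto simp: num_bases_containing_def card_image[OF inj])
  \<comment> \<open>A subfamily of a finite family is the whole family as soon as the cardinalities
    agree.\<close>
  also have "\<dots> \<longleftrightarrow> ?T ` ?Bg = ?Bf"
    using card_subset_eq[OF finite_Collect_basis into] by auto
  also have "\<dots> \<longleftrightarrow> (\<forall>I. indep I \<longrightarrow> indep (?T I))"
  proof (intro iffI allI impI)
    fix I assume onto: "?T ` ?Bg = ?Bf" and I: "indep I"
    show "indep (?T I)"
    proof (cases "f \<in> I")
      case True
      obtain B where B: "basis B" "I \<subseteq> B" using indep_extends_to_basis[OF I] .
      \<comment> \<open>Since \<open>B\<close> contains \<open>f\<close>, it is the image of a basis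
        through \<open>g\<close>. The involution maps \<open>B\<close> back to that basis, which
        contains the image of \<open>I\<close>.\<close>
      then have "B \<in> ?T ` ?Bg" using onto True by blast
      then have "indep (?T B)" by (auto simp: image_image basis_def)
      then show ?thesis using B(2) by (blast intro: indep_subset)
    next
      case False
      then show ?thesis using freer_indep_transpose[OF assms(1,2) I] by blast
    qed
  next
    assume preserves: "\<forall>I. indep I \<longrightarrow> indep (?T I)"
    \<comment> \<open>The preimage of a basis through \<open>f\<close> is its own image under the
      interchange.\<close>
    have "?Bf \<subseteq> ?T ` ?Bg"
    proof
      fix B assume B: "B \<in> ?Bf"
      then have "basis (?T B)" using preserves basis_transpose by (simp add: basis_def)
      moreover have "g \<in> ?T B" using B by (auto intro: image_eqI[of _ _ f])
      moreover have "B = ?T (?T B)" by (simp add: image_image)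
      ultimately show "B \<in> ?T ` ?Bg" by blast
    qed
    with into show "?T ` ?Bg = ?Bf" by (rule subset_antisym)
  qed
  also have "\<dots> \<longleftrightarrow> clones f g" using clones_iff[OF assms(2,3)] ..
  finally show ?thesis .
qed

end

theorem theorem11:
  fixes E :: "'a set" and indep :: "'a set \<Rightarrow> bool" and f g :: 'a
  assumes "matroid E indep"
    and "f \<in> E" and "g \<in> E" and "f \<noteq> g"
    and "matroid.freer E indep f g"
  shows "matroid.num_bases_containing indep f = matroid.num_bases_containing indep g
    \<longleftrightarrow> matroid.clones E indep f g"
  by (rule matroid.freer_num_bases_eq_iff_clones[OF assms(1,5,2,3)])

end
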